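(* Let $M:\mathbb{R}\to\mathbb{R}$ be a $2$-concave Orlicz function. Define $\varphi:(-\infty,0)\to\mathbb{R}$ by $\varphi(\alpha)=\log\int_{\mathbb{R}}e^{\alpha M(x)}\,\mathrm{d}x$, and let $\alpha_*<0$ be chosen in such a way that $\varphi'(\alpha_* )=1$. Then $$\lim_{d\to\infty}\mathrm{vr}\big(B_M^d(d)\big)=\frac{1}{\sqrt{2\pi e}\,M^{-1}(1)}\,e^{\varphi(\alpha_* )-\alpha_*}.$$
   Context: An Orlicz function is a convex function $M:\mathbb{R}\to\mathbb{R}$ with $M(t)=M(-t)$ for all $t$, $M(0)=0$, and $M(t)>0$ for $t\neq0$. For such $M$ the integral $\int_{\mathbb{R}}e^{-aM(x)}\,\mathrm{d}x$ is finite for every $a>0$ and infinitely differentiable as a function of $a\in(0,\infty)$. $M$ is called $2$-concave if the function $t\mapsto M(\sqrt{t})$ is concave on $[0,\infty)$. $M^{-1}$ denotes the inverse of the restriction of $M$ to $[0,\infty)$, so $M^{-1}(1)$ is the unique $t>0$ with $M(t)=1$. For $d\in\mathbb{N}$, $$B_M^d(d)=\Big\{x=(x_i)_{i=1}^d\in\mathbb{R}^d:\ \sum_{i=1}^dM(x_i)\le d\Big\}.$$ For a $d$-dimensional convex body $K$, the volume ratio is $$\mathrm{vr}(K):=\inf\left(\frac{\mathrm{vol}_d(K)}{\mathrm{vol}_d(\mathscr{E})}\right)^{1/d},$$ where the infimum is taken over all ellipsoids $\mathscr{E}$ contained in $K$, and $\mathrm{vol}_d$ is $d$-dimensional Lebesgue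 measure. *)

theory Defs
  imports "HOL-Analysis.Analysis"
begin

definition Orlicz :: "(real \<Rightarrow> real) \<Rightarrow> bool" where
  "Orlicz M \<longleftrightarrow> convex_on UNIV M \<and> (\<forall>t. M (- t) = M t) \<and> M 0 = 0 \<and> (\<forall>t. t \<noteq> 0 \<longrightarrow> M t > 0)"

definition two_concave :: "(real \<Rightarrow> real) \<Rightarrow> bool" where
  "two_concave M \<longleftrightarrow> concave_on {0..} (\<lambda>t. M (sqrt t))"

definition Orlicz_inv :: "(real \<Rightarrow> real) \<Rightarrow> real \<Rightarrow> real" where
  "Orlicz_inv M = the_inv_into {0..} M"

definition log_partition :: "(real \<Rightarrow> real) \<Rightarrow> real \<Rightarrow> real" where
  "log_partition M \<alpha> = ln (\<integral>x. exp (\<alpha> * M x) \<partial>lborel)"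

(* Since the dimension varies, R^d is modelled by the functions nat => real that are
   undefined outside {..<d}; this is the space of the d-fold product of lborel. *)

definition Rd :: "nat \<Rightarrow> (nat \<Rightarrow> real) set" where
  "Rd d = {..<d} \<rightarrow>\<^sub>E UNIV"

(* Lebesgue measure on the Borel sets of R^d; non-Borel sets get the default value 0. *)
definition vol :: "nat \<Rightarrow> (nat \<Rightarrow> real) set \<Rightarrow> real" where
  "vol d = measure (\<Pi>\<^sub>M i\<in>{..<d}. lborel)"

definition Orlicz_ball :: "(real \<Rightarrow> real) \<Rightarrow> nat \<Rightarrow> (nat \<Rightarrow> real) set" where
  "Orlicz_ball M d = {x \<in> Rd d. (\<Sum>i<d. M (x i)) \<le> real d}"

definition unit_ball :: "nat \<Rightarrow> (nat \<Rightarrow> real) set" where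
  "unit_ball d = {x \<in> Rd d. (\<Sum>i<d. (x i)\<^sup>2) \<le> 1}"

definition affine_map ::
  "nat \<Rightarrow> (nat \<Rightarrow> nat \<Rightarrow> real) \<Rightarrow> (nat \<Rightarrow> real) \<Rightarrow> (nat \<Rightarrow> real) \<Rightarrow> (nat \<Rightarrow> real)" where
  "affine_map d A c x = (\<lambda>i\<in>{..<d}. c i + (\<Sum>j<d. A i j * x j))"

(* Nondegenerate, with arbitrary centre c. *)
definition ellipsoid :: "nat \<Rightarrow> (nat \<Rightarrow> real) set \<Rightarrow> bool" where
  "ellipsoid d E \<longleftrightarrow>
    (\<exists>A c. bij_betw (affine_map d A c) (Rd d) (Rd d) \<and> E = affine_map d A c ` unit_ball d)"

definition volume_ratio :: "nat \<Rightarrow> (nat \<Rightarrow> real) set \<Rightarrow> real" where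
  "volume_ratio d K = (INF E\<in>{E. ellipsoid d E \<and> E \<subseteq> K}. (vol d K / vol d E) powr (1 / real d))"

end

theory Submission
  imports Defs "HOL-Probability.Probability"
begin

text \<open>Put r = sqrt d * t with M t = 1. Concavity of M (sqrt t) puts the Euclidean ball of radius r
  inside the Orlicz ball, and no ellipsoid in the Orlicz ball has larger volume: Gram-Schmidt on the rows
  of its matrix writes an ellipsoid as c + L B with L lower triangular; averaging M over the sign vectors, all scaled by 1 / sqrt d,
  bounds the diagonal of L, and AM-GM bounds its product. The volume ratio is thus that of this
  ball. The d-th root of the volume of an Orlicz ball tends to exp (log_partition M a - a):
  the upper bound is Markov's inequality for the density exp (a * sum M), the lower bound says that this
  density concentrates where sum M is close to d, with Chernoff bounds read off from the derivative
  of the log partition function. The Euclidean ball is the case M x = x^2 of the same limit.\<close>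

section \<open>Lebesgue measure on R^d and triangular affine maps\<close>

abbreviation lborel_Rd :: "nat \<Rightarrow> (nat \<Rightarrow> real) measure" where
  "lborel_Rd d \<equiv> \<Pi>\<^sub>M i\<in>{..<d}. lborel"

interpretation lborel_Rd: product_sigma_finite "\<lambda>_::nat. lborel :: real measure" ..

lemma space_lborel_Rd: "space (lborel_Rd d) = Rd d"
  by (simp add: space_PiM Rd_def)

lemma Rd_eqI:
  assumes "x \<in> Rd d" "y \<in> Rd d" "\<And>i. i < d \<Longrightarrow> x i = y i"
  shows "x = y"
  using assms unfolding Rd_def by (auto intro: PiE_ext)

lemma restrict_in_Rd [simp]: "restrict f {..<d} \<in> Rd d"
  by (simp add: Rd_def)

lemma affine_map_in_Rd [simp]: "affine_map d A c x \<in> Rd d"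
  by (simp add: affine_map_def)

lemma measurable_affine_map [measurable]: "affine_map d A c \<in> lborel_Rd d \<rightarrow>\<^sub>M lborel_Rd d"
  unfolding affine_map_def by measurable

text \<open>Induction on the dimension by Fubini: with all coordinates but the last fixed, the last
  coordinate of the image is affine in the last variable with slope \<open>L d d\<close>, so
  one-dimensional substitution contributes the factor \<open>\<bar>L d d\<bar>\<close>. Triangular
  matrices suffice because every ellipsoid is brought to that form below.\<close>

lemma nn_integral_triangular_affine_map:
  assumes "\<And>i j. i < j \<Longrightarrow> j < d \<Longrightarrow> L i j = 0"
    and "\<And>i. i < d \<Longrightarrow> L i i \<noteq> 0"
    and "f \<in> borel_measurable (lborel_Rd d)"
  shows "(\<integral>\<^sup>+x. f x \<partial>lborel_Rd d) =
    ennreal (\<Prod>i<d. \<bar>L i i\<bar>) * (\<integral>\<^sup>+x. f (affine_map d L c x) \<partial>lborel_Rd d)"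
  using assms
proof (induction d arbitrary: f)
  case 0
  then show ?case
    by (simp add: product_sigma_finite.nn_integral_empty[OF lborel_Rd.product_sigma_finite_axioms] affine_map_def
        del: nn_integral_const)
next
  case (Suc d)
  note [measurable] = Suc.prems(3)
  have [measurable]: "f \<in> borel_measurable (Pi\<^sub>M (insert d {..<d}) (\<lambda>_. lborel))"
    using Suc.prems(3) by (simp add: lessThan_Suc)
  define g where "g x = (\<integral>\<^sup>+t. f (x(d := t)) \<partial>lborel)" for x
  have meas_g: "g \<in> borel_measurable (lborel_Rd d)"
    unfolding g_def by measurable
  \<comment> \<open>Above the diagonal \<open>L\<close> vanishes, so the first \<open>d\<close>
    coordinates of the image do not see \<open>t\<close>.\<close>
  have aff: "(affine_map d L c x)(d := c d + (\<Sum>j<d. L d j * x j) + L d d * t)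
      = affine_map (Suc d) L c (x(d := t))" if "x \<in> Rd d" for x t
    using Suc.prems(1) by (intro ext) (auto simp: affine_map_def less_Suc_eq)
  have [measurable]: "affine_map (Suc d) L c \<in> Pi\<^sub>M (insert d {..<d}) (\<lambda>_. lborel) \<rightarrow>\<^sub>M Pi\<^sub>M (insert d {..<d}) (\<lambda>_. lborel)"
    using measurable_affine_map[of "Suc d" L c] by (simp add: lessThan_Suc)
  have "(\<integral>\<^sup>+x. f x \<partial>lborel_Rd (Suc d)) = (\<integral>\<^sup>+x. g x \<partial>lborel_Rd d)"
    unfolding g_def lessThan_Suc by (subst lborel_Rd.product_nn_integral_insert) auto
  also have "\<dots> = ennreal (\<Prod>i<d. \<bar>L i i\<bar>) * (\<integral>\<^sup>+x. g (affine_map d L c x) \<partial>lborel_Rd d)"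
    using Suc.prems meas_g by (intro Suc.IH) auto
  also have "(\<integral>\<^sup>+x. g (affine_map d L c x) \<partial>lborel_Rd d) =
      (\<integral>\<^sup>+x. \<bar>L d d\<bar> * (\<integral>\<^sup>+t. f (affine_map (Suc d) L c (x(d := t))) \<partial>lborel) \<partial>lborel_Rd d)"
  proof (rule nn_integral_cong)
    fix x assume x: "x \<in> space (lborel_Rd d)"
    have "(\<lambda>t. (affine_map d L c x)(d := t)) \<in> lborel \<rightarrow>\<^sub>M Pi\<^sub>M (insert d {..<d}) (\<lambda>_. lborel)"
      by (rule measurable_fun_upd[where J = "{..<d}"]) (auto simp: space_lborel_Rd)
    from measurable_compose[OF this, of f borel]
    have "(\<lambda>t. f ((affine_map d L c x)(d := t))) \<in> borel_measurable borel"
      using Suc.prems(3) by (simp add: lessThan_Suc)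
    from nn_integral_real_affine[OF this, of "L d d" "c d + (\<Sum>j<d. L d j * x j)"]
    show "g (affine_map d L c x) = \<bar>L d d\<bar> * (\<integral>\<^sup>+t. f (affine_map (Suc d) L c (x(d := t))) \<partial>lborel)"
      using x Suc.prems(2) by (simp add: g_def aff space_lborel_Rd)
  qed
  also have "\<dots> = \<bar>L d d\<bar> * (\<integral>\<^sup>+x. f (affine_map (Suc d) L c x) \<partial>lborel_Rd (Suc d))"
    unfolding lessThan_Suc
    by (subst lborel_Rd.product_nn_integral_insert) (auto intro!: nn_integral_cmult)
  finally show ?case
    by (simp add: ennreal_mult prod_nonneg mult.assoc)
qed

lemma sets_unit_ball [measurable]: "unit_ball d \<in> sets (lborel_Rd d)"
proof -
  have "unit_ball d = {x \<in> space (lborel_Rd d). (\<Sum>i<d. (x i)\<^sup>2) \<le> 1}"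
    by (simp add: unit_ball_def space_lborel_Rd)
  also have "\<dots> \<in> sets (lborel_Rd d)" by measurable
  finally show ?thesis .
qed

section \<open>Inverse matrices, measurability and volume of affine images\<close>

text \<open>Surjectivity solves for the columns of a right inverse \<open>B\<close>; injectivity
  then turns it into a left inverse. The left inverse describes ellipsoids by inequalities, the
  right inverse encodes independence of the rows of \<open>A\<close> for Gram-Schmidt.\<close>

lemma affine_bij_left_inverse:
  assumes "bij_betw (affine_map d A c) (Rd d) (Rd d)"
  obtains B where
    "\<And>x k. k < d \<Longrightarrow> (\<Sum>i<d. B k i * (affine_map d A c x i - c i)) = x k"
    "\<And>i k. i < d \<Longrightarrow> k < d \<Longrightarrow> (\<Sum>j<d. A i j * B j k) = (if i = k then 1 else 0)"
proof -
  have inj: "inj_on (affine_map d A c) (Rd d)" and surj: "affine_map d A c ` Rd d = Rd d"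
    using assms by (auto simp: bij_betw_def)
  \<comment> \<open>The image point \<open>c\<close> plus the \<open>k\<close>-th unit vector; its
    preimage \<open>X k\<close> is the \<open>k\<close>-th column of \<open>B\<close>.\<close>
  define T where "T k = (\<lambda>i\<in>{..<d}. c i + (if i = k then 1 else 0))" for k
  have "\<exists>x. x \<in> Rd d \<and> affine_map d A c x = T k" for k
  proof -
    have "T k \<in> affine_map d A c ` Rd d" unfolding surj by (simp add: T_def)
    then show ?thesis by auto
  qed
  then obtain X where X: "\<And>k. X k \<in> Rd d" "\<And>k. affine_map d A c (X k) = T k" by metis
  have AB: "(\<Sum>j<d. A i j * X k j) = (if i = k then 1 else 0)" if "i < d" for i k
    using arg_cong[OF X(2)[of k], of "\<lambda>f. f i"] that by (simp add: affine_map_def T_def)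
  show thesis
  proof
    show "(\<Sum>j<d. A i j * X k j) = (if i = k then 1 else 0)" if "i < d" "k < d" for i k
      by (rule AB[OF that(1)])
    fix x k assume "k < d"
    define y where "y = (\<lambda>k\<in>{..<d}. \<Sum>i<d. X i k * (affine_map d A c x i - c i))"
    \<comment> \<open>Here \<open>y\<close> is \<open>B\<close> applied to \<open>A x\<close>. As
      \<open>A B\<close> is the identity, \<open>y\<close> and \<open>x\<close> have the same
      image.\<close>
    have "affine_map d A c y = affine_map d A c (restrict x {..<d})"
    proof (rule Rd_eqI)
      fix i assume i: "i < d"
      have "(\<Sum>j<d. A i j * y j) = (\<Sum>j<d. \<Sum>k<d. A i j * X k j * (affine_map d A c x k - c k))"
        by (simp add: y_def sum_distrib_left mult.assoc)
      also have "\<dots> = (\<Sum>k<d. (\<Sum>j<d. A i j * X k j) * (affine_map d A c x k - c k))"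
        by (subst sum.swap) (simp add: sum_distrib_right)
      also have "\<dots> = (\<Sum>k<d. if i = k then affine_map d A c x k - c k else 0)"
        using i by (intro sum.cong) (auto simp: AB)
      also have "\<dots> = affine_map d A c x i - c i"
        using i by simp
      finally show "affine_map d A c y i = affine_map d A c (restrict x {..<d}) i"
        using i by (simp add: affine_map_def)
    qed auto
    then have "y = restrict x {..<d}"
      using inj by (rule_tac inj_onD[OF inj]) (auto simp: y_def)
    then show "(\<Sum>i<d. X i k * (affine_map d A c x i - c i)) = x k"
      using \<open>k < d\<close> by (metis (no_types, lifting) y_def lessThan_iff restrict_apply)
  qed
qed

text \<open>Pulling points back by the left inverse turns membership into a polynomial inequality.
  Measurability matters because \<open>vol\<close> is 0 on non-Borel sets.\<close>

lemma sets_ellipsoid: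
  assumes "ellipsoid d E"
  shows "E \<in> sets (lborel_Rd d)"
proof -
  obtain A c where bij: "bij_betw (affine_map d A c) (Rd d) (Rd d)"
    and E: "E = affine_map d A c ` unit_ball d"
    using assms unfolding ellipsoid_def by auto
  obtain B where B: "\<And>x k. k < d \<Longrightarrow> (\<Sum>i<d. B k i * (affine_map d A c x i - c i)) = x k"
    using affine_bij_left_inverse[OF bij] by metis
  have surj: "\<And>y. y \<in> Rd d \<Longrightarrow> \<exists>x\<in>Rd d. y = affine_map d A c x"
    using bij by (auto simp: bij_betw_def)
  have "E = {y \<in> space (lborel_Rd d). (\<Sum>k<d. (\<Sum>i<d. B k i * (y i - c i))\<^sup>2) \<le> 1}"
    unfolding E unit_ball_def space_lborel_Rd using surj by (fastforce simp: B)
  also have "\<dots> \<in> sets (lborel_Rd d)" by measurable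
  finally show ?thesis .
qed

text \<open>Change of variables applied to the indicator of the image. Forward substitution along
  the nonzero diagonal gives injectivity, so this indicator composed with the map is the indicator
  of \<open>S\<close>.\<close>

lemma vol_triangular_image:
  assumes tri: "\<And>i j. i < j \<Longrightarrow> j < d \<Longrightarrow> L i j = 0"
    and nz: "\<And>i. i < d \<Longrightarrow> L i i \<noteq> 0"
    and S: "S \<in> sets (lborel_Rd d)"
    and img: "affine_map d L c ` S \<in> sets (lborel_Rd d)"
  shows "vol d (affine_map d L c ` S) = (\<Prod>i<d. \<bar>L i i\<bar>) * vol d S"
proof -
  have inj: "inj_on (affine_map d L c) (Rd d)"
  proof (rule inj_onI)
    fix x y assume xy: "x \<in> Rd d" "y \<in> Rd d" "affine_map d L c x = affine_map d L c y"
    have "x i = y i" if "i < d" for i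
      using that
    proof (induction i rule: less_induct)
      case (less i)
      have "(\<Sum>j<d. L i j * (x j - y j)) = 0"
        using arg_cong[OF xy(3), of "\<lambda>f. f i"] less.prems
        by (simp add: affine_map_def algebra_simps sum_subtractf)
      also have "(\<Sum>j<d. L i j * (x j - y j)) = (\<Sum>j<d. if j = i then L i i * (x i - y i) else 0)"
        using less.IH tri by (intro sum.cong refl) (metis (no_types, opaque_lifting) diff_self lessThan_iff linorder_neqE_nat mult_eq_0_iff)
      finally show ?case using less.prems nz by simp
    qed
    then show "x = y" using xy by (intro Rd_eqI)
  qed
  have S': "S \<subseteq> Rd d" using sets.sets_into_space[OF S] by (simp add: space_lborel_Rd)
  have "emeasure (lborel_Rd d) (affine_map d L c ` S) = (\<integral>\<^sup>+x. indicator (affine_map d L c ` S) x \<partial>lborel_Rd d)"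
    using img by simp
  also have "\<dots> = ennreal (\<Prod>i<d. \<bar>L i i\<bar>) *
      (\<integral>\<^sup>+x. indicator (affine_map d L c ` S) (affine_map d L c x) \<partial>lborel_Rd d)"
    using tri nz img by (intro nn_integral_triangular_affine_map) auto
  also have "(\<integral>\<^sup>+x. indicator (affine_map d L c ` S) (affine_map d L c x) \<partial>lborel_Rd d) =
      (\<integral>\<^sup>+x. indicator S x \<partial>lborel_Rd d)"
    using S' inj by (intro nn_integral_cong)
      (auto simp: indicator_def space_lborel_Rd dest: inj_onD)
  also have "\<dots> = emeasure (lborel_Rd d) S" using S by simp
  finally show ?thesis
    by (simp add: vol_def measure_def enn2real_mult prod_nonneg)
qed

section \<open>Gram-Schmidt and the triangular form of ellipsoids\<close>

definition orthonormal_rows :: "nat \<Rightarrow> nat \<Rightarrow> (nat \<Rightarrow> nat \<Rightarrow> real) \<Rightarrow> bool" where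
  "orthonormal_rows d n Q \<longleftrightarrow>
    (\<forall>i<n. \<forall>k<n. (\<Sum>j<d. Q i j * Q k j) = (if i = k then 1 else 0))"

text \<open>The factorisation A = L Q, built row by row. The right inverse \<open>X\<close> supplies
  independence: its column \<open>n\<close> annihilates the rows of \<open>A\<close> before
  \<open>n\<close> but not row \<open>n\<close>. The last conjunct says in dual form that the rows
  of \<open>Q\<close> lie in the span of those of \<open>A\<close>; it carries the
  induction.\<close>

lemma gram_schmidt_rows:
  fixes A X :: "nat \<Rightarrow> nat \<Rightarrow> real"
  assumes X: "\<And>i k. i < d \<Longrightarrow> k < d \<Longrightarrow> (\<Sum>j<d. A i j * X j k) = (if i = k then 1 else 0)"
    and "n \<le> d"
  shows "\<exists>L Q. orthonormal_rows d n Q \<and> (\<forall>i<n. \<forall>j. A i j = (\<Sum>k\<le>i. L i k * Q k j)) \<and>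
    (\<forall>i<n. L i i \<noteq> 0) \<and>
    (\<forall>x. (\<forall>i<n. (\<Sum>j<d. A i j * x j) = 0) \<longrightarrow> (\<forall>i<n. (\<Sum>j<d. Q i j * x j) = 0))"
  using assms(2)
proof (induction n)
  case 0
  show ?case by (simp add: orthonormal_rows_def)
next
  case (Suc n)
  then have "n \<le> d" by simp
  from Suc.IH[OF this] obtain L Q where Q: "orthonormal_rows d n Q"
    and A': "\<forall>i<n. \<forall>j. A i j = (\<Sum>k\<le>i. L i k * Q k j)"
    and L': "\<forall>i<n. L i i \<noteq> 0"
    and span': "\<forall>x. (\<forall>i<n. (\<Sum>j<d. A i j * x j) = 0) \<longrightarrow> (\<forall>i<n. (\<Sum>j<d. Q i j * x j) = 0)"
    by (elim exE conjE) (rule that)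
  note A = A'[rule_format] and L = L'[rule_format]
  have span: "(\<Sum>j<d. Q i j * x j) = 0"
    if "\<And>i. i < n \<Longrightarrow> (\<Sum>j<d. A i j * x j) = 0" "i < n" for x i
    using span' that by simp
  define l where "l k = (\<Sum>j<d. A n j * Q k j)" for k
  \<comment> \<open>The component of row \<open>n\<close> orthogonal to the rows of \<open>Q\<close>
    found so far; \<open>N\<close> is its length.\<close>
  define v where "v j = A n j - (\<Sum>k<n. l k * Q k j)" for j
  define N where "N = sqrt (\<Sum>j<d. (v j)\<^sup>2)"
  have dot_v: "(\<Sum>j<d. v j * x j) = (\<Sum>j<d. A n j * x j) - (\<Sum>k<n. l k * (\<Sum>j<d. Q k j * x j))" for x
    unfolding v_def
    by (simp add: left_diff_distrib sum_subtractf sum_distrib_left sum_distrib_right mult.assoc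
        sum.swap[of _ "{..<n}"])
  \<comment> \<open>If \<open>v\<close> vanished, row \<open>n\<close> would be a combination of
    earlier rows of \<open>Q\<close>, all orthogonal to column \<open>n\<close> of \<open>X\<close>;
    but row \<open>n\<close> has product 1 with that column.\<close>
  have "N \<noteq> 0"
  proof
    assume "N = 0"
    then have v0: "v j = 0" if "j < d" for j
      using that by (simp add: N_def sum_nonneg_eq_0_iff)
    have "(\<Sum>j<d. A i j * X j n) = 0" if "i < n" for i
      using X[of i n] that Suc.prems by simp
    then have "(\<Sum>j<d. Q k j * X j n) = 0" if "k < n" for k
      using span[of "\<lambda>j. X j n"] that by blast
    then have "(\<Sum>j<d. A n j * X j n) = 0"
      using dot_v[of "\<lambda>j. X j n"] v0 by simp
    then show False using X[of n n] Suc.prems by simp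
  qed
  have N2: "(\<Sum>j<d. v j * v j) = N * N"
    by (simp add: N_def sum_nonneg power2_eq_square)
  have v_orth: "(\<Sum>j<d. v j * Q k j) = 0" if "k < n" for k
  proof -
    have "(\<Sum>m<n. l m * (\<Sum>j<d. Q m j * Q k j)) = (\<Sum>m<n. if m = k then l m else 0)"
      using Q that by (intro sum.cong) (auto simp: orthonormal_rows_def)
    then show ?thesis using that dot_v[of "Q k"] by (simp add: l_def)
  qed
  define Q' where "Q' = Q(n := (\<lambda>j. v j / N))"
  define L' where "L' = L(n := l(n := N))"
  have dot_Q': "(\<Sum>j<d. v j / N * x j) = (\<Sum>j<d. v j * x j) / N" for x
    by (simp add: sum_divide_distrib)
  have 1: "(\<Sum>j<d. Q' i j * Q' k j) = (if i = k then 1 else 0)" if ik: "i < Suc n" "k < Suc n" for i k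
  proof -
    consider "i = n" "k = n" | "i = n" "k < n" | "i < n" "k = n" | "i < n" "k < n"
      using ik by linarith
    then show ?thesis
    proof cases
      case 1
      have "(\<Sum>j<d. v j / N * (v j / N)) = (\<Sum>j<d. v j * v j) / (N * N)"
        by (simp add: sum_divide_distrib)
      then show ?thesis using 1 \<open>N \<noteq> 0\<close> by (simp add: Q'_def N2)
    next
      case 2
      then show ?thesis unfolding Q'_def by (simp add: dot_Q'[of "Q k", simplified] v_orth)
    next
      case 3
      then show ?thesis unfolding Q'_def
        by (simp add: mult.commute[of "Q _ _"] dot_Q'[of "Q i", simplified] v_orth)
    next
      case 4
      then show ?thesis using Q by (simp add: Q'_def orthonormal_rows_def)
    qed
  qed
  have 2: "A i j = (\<Sum>k\<le>i. L' i k * Q' k j)" if "i < Suc n" for i j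
  proof (cases "i = n")
    case True
    have "(\<Sum>k\<le>n. L' n k * Q' k j) = (\<Sum>k<n. L' n k * Q' k j) + L' n n * Q' n j"
      by (simp add: lessThan_Suc_atMost[symmetric])
    also have "(\<Sum>k<n. L' n k * Q' k j) = (\<Sum>k<n. l k * Q k j)"
      by (intro sum.cong) (auto simp: L'_def Q'_def)
    finally show ?thesis using True \<open>N \<noteq> 0\<close> by (simp add: L'_def Q'_def v_def)
  next
    case False
    with that have "i < n" by simp
    then show ?thesis by (subst A) (auto simp: L'_def Q'_def intro!: sum.cong)
  qed
  have 3: "(\<Sum>j<d. Q' i j * x j) = 0"
    if x: "\<And>i. i < Suc n \<Longrightarrow> (\<Sum>j<d. A i j * x j) = 0" and "i < Suc n" for x i
  proof -
    have Q0: "(\<Sum>j<d. Q k j * x j) = 0" if "k < n" for k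
      using span[of x k] x that by simp
    show ?thesis
    proof (cases "i = n")
      case True
      then show ?thesis using Q0 x[of n] dot_Q'[of x] dot_v[of x] by (simp add: Q'_def)
    next
      case False
      then show ?thesis using \<open>i < Suc n\<close> Q0 by (simp add: Q'_def)
    qed
  qed
  have 4: "\<forall>i<Suc n. L' i i \<noteq> 0"
    using L \<open>N \<noteq> 0\<close> by (simp add: L'_def less_Suc_eq)
  show ?case
  proof (rule exI[of _ L'], rule exI[of _ Q'], intro conjI allI impI)
    show "orthonormal_rows d (Suc n) Q'"
      unfolding orthonormal_rows_def using 1 by simp
  qed (use 2 3 4 in simp_all)
qed

lemma orthonormal_rows_mult_transpose:
  assumes "orthonormal_rows d d Q" "i < d"
  shows "(\<Sum>j<d. Q i j * (\<Sum>k<d. Q k j * y k)) = y i"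
proof -
  have "(\<Sum>j<d. Q i j * (\<Sum>k<d. Q k j * y k)) = (\<Sum>k<d. (\<Sum>j<d. Q i j * Q k j) * y k)"
    by (simp add: sum_distrib_left sum_distrib_right mult.assoc) (rule sum.swap)
  also have "\<dots> = (\<Sum>k<d. if k = i then y k else 0)"
    using assms by (intro sum.cong) (auto simp: orthonormal_rows_def)
  finally show ?thesis using assms by simp
qed

text \<open>Since Q Q^T is the identity, the transpose of \<open>Q\<close> preserves the Euclidean
  norm.\<close>

lemma orthonormal_rows_norm_transpose:
  assumes "orthonormal_rows d d Q"
  shows "(\<Sum>j<d. (\<Sum>k<d. Q k j * y k)\<^sup>2) = (\<Sum>i<d. (y i)\<^sup>2)"
proof -
  have "(\<Sum>j<d. (\<Sum>k<d. Q k j * y k)\<^sup>2) = (\<Sum>j<d. (\<Sum>i<d. Q i j * y i) * (\<Sum>k<d. Q k j * y k))"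
    by (simp add: power2_eq_square)
  also have "\<dots> = (\<Sum>i<d. y i * (\<Sum>j<d. Q i j * (\<Sum>k<d. Q k j * y k)))"
    unfolding sum_distrib_right sum_distrib_left[of "y _"]
    by (subst sum.swap) (simp add: mult_ac)
  also have "\<dots> = (\<Sum>i<d. (y i)\<^sup>2)"
    using assms by (simp add: orthonormal_rows_mult_transpose power2_eq_square)
  finally show ?thesis .
qed

text \<open>Only Q Q^T = I is at hand, not Q^T Q = I. That \<open>Q\<close> does not increase the
  norm follows from 0 \<le> |x - z|^2 with y = Q x and z = Q^T y, as both <x,z> and |z|^2 equal
  |y|^2. Conversely Q^T y is a preimage of \<open>y\<close> in the ball.\<close>

lemma orthonormal_image_unit_ball:
  assumes Q: "orthonormal_rows d d Q"
  shows "affine_map d Q (\<lambda>_. 0) ` unit_ball d = unit_ball d"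
proof (intro equalityI subsetI)
  fix y assume "y \<in> affine_map d Q (\<lambda>_. 0) ` unit_ball d"
  then obtain x where x: "x \<in> unit_ball d" and y: "y = affine_map d Q (\<lambda>_. 0) x" by auto
  define z where "z j = (\<Sum>k<d. Q k j * y k)" for j
  have "(\<Sum>j<d. x j * z j) = (\<Sum>k<d. y k * (\<Sum>j<d. Q k j * x j))"
    unfolding z_def sum_distrib_left by (subst sum.swap) (simp add: mult_ac)
  also have "\<dots> = (\<Sum>k<d. (y k)\<^sup>2)"
    by (simp add: y affine_map_def power2_eq_square)
  finally have xz: "(\<Sum>j<d. x j * z j) = (\<Sum>k<d. (y k)\<^sup>2)" .
  have "0 \<le> (\<Sum>j<d. (x j - z j)\<^sup>2)" by (intro sum_nonneg) auto
  also have "\<dots> = (\<Sum>j<d. (x j)\<^sup>2) - 2 * (\<Sum>j<d. x j * z j) + (\<Sum>j<d. (z j)\<^sup>2)"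
    by (simp add: power2_diff sum.distrib sum_subtractf sum_distrib_left mult.assoc)
  also have "(\<Sum>j<d. (z j)\<^sup>2) = (\<Sum>k<d. (y k)\<^sup>2)"
    unfolding z_def by (rule orthonormal_rows_norm_transpose[OF Q])
  finally show "y \<in> unit_ball d"
    using x xz by (simp add: unit_ball_def y)
next
  fix y assume y: "y \<in> unit_ball d"
  define x where "x = (\<lambda>j\<in>{..<d}. \<Sum>k<d. Q k j * y k)"
  have "x \<in> unit_ball d"
    using y orthonormal_rows_norm_transpose[OF Q, of y] by (simp add: unit_ball_def x_def)
  moreover have "affine_map d Q (\<lambda>_. 0) x = y"
    using y by (intro Rd_eqI)
      (auto simp: unit_ball_def affine_map_def x_def orthonormal_rows_mult_transpose[OF Q])
  ultimately show "y \<in> affine_map d Q (\<lambda>_. 0) ` unit_ball d" by force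
qed

lemma ellipsoid_triangular:
  assumes "ellipsoid d E"
  obtains L c where "\<And>i j. i < j \<Longrightarrow> j < d \<Longrightarrow> L i j = 0" "\<And>i. i < d \<Longrightarrow> L i i \<noteq> 0"
    "E = affine_map d L c ` unit_ball d"
proof -
  obtain A c where bij: "bij_betw (affine_map d A c) (Rd d) (Rd d)"
    and E: "E = affine_map d A c ` unit_ball d"
    using assms unfolding ellipsoid_def by auto
  obtain X where X: "\<And>i k. i < d \<Longrightarrow> k < d \<Longrightarrow> (\<Sum>j<d. A i j * X j k) = (if i = k then 1 else 0)"
    using affine_bij_left_inverse[OF bij] by metis
  obtain L Q where Q: "orthonormal_rows d d Q"
    and A: "\<And>i j. i < d \<Longrightarrow> A i j = (\<Sum>k\<le>i. L i k * Q k j)" and L: "\<And>i. i < d \<Longrightarrow> L i i \<noteq> 0"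
    using gram_schmidt_rows[OF X order_refl] by metis
  \<comment> \<open>Gram-Schmidt leaves the entries of \<open>L\<close> above the diagonal
    unspecified; they are set to 0.\<close>
  define L' where "L' i k = (if k \<le> i then L i k else 0)" for i k
  have A': "A i j = (\<Sum>k<d. L' i k * Q k j)" if "i < d" for i j
    unfolding A[OF that] L'_def using that by (intro sum.mono_neutral_cong_left) auto
  have "affine_map d A c x = affine_map d L' c (affine_map d Q (\<lambda>_. 0) x)" for x
  proof (rule Rd_eqI)
    fix i assume "i < d"
    then show "affine_map d A c x i = affine_map d L' c (affine_map d Q (\<lambda>_. 0) x) i"
      unfolding affine_map_def
      by (simp add: A' sum_distrib_left sum_distrib_right mult.assoc) (rule sum.swap)
  qed auto
  then have "E = affine_map d L' c ` affine_map d Q (\<lambda>_. 0) ` unit_ball d"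
    unfolding E image_image by simp
  also have "\<dots> = affine_map d L' c ` unit_ball d"
    by (simp add: orthonormal_image_unit_ball[OF Q])
  finally show thesis
    using L by (intro that[of L' c]) (auto simp: L'_def)
qed

section \<open>Elementary properties of Orlicz functions\<close>

lemma Orlicz_convex: "Orlicz M \<Longrightarrow> convex_on UNIV M"
  and Orlicz_minus: "Orlicz M \<Longrightarrow> M (- t) = M t"
  and Orlicz_zero: "Orlicz M \<Longrightarrow> M 0 = 0"
  and Orlicz_pos: "Orlicz M \<Longrightarrow> t \<noteq> 0 \<Longrightarrow> 0 < M t"
  by (auto simp: Orlicz_def)

lemma Orlicz_nonneg: "Orlicz M \<Longrightarrow> 0 \<le> M t"
  by (metis Orlicz_pos Orlicz_zero less_eq_real_def)

lemma Orlicz_abs: "Orlicz M \<Longrightarrow> M \<bar>t\<bar> = M t"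
  by (simp add: abs_real_def Orlicz_minus)

lemma Orlicz_shrink:
  assumes "Orlicz M" "0 \<le> k" "k \<le> 1"
  shows "M (k * x) \<le> k * M x"
  using convex_onD[OF Orlicz_convex[OF assms(1)], of k 0 x] assms Orlicz_zero[OF assms(1)]
  by simp

lemma Orlicz_strict_mono:
  assumes M: "Orlicz M" and "0 \<le> x" "x < y"
  shows "M x < M y"
proof -
  have "M x = M (x / y * y)" using assms by simp
  also have "\<dots> \<le> x / y * M y" using assms by (intro Orlicz_shrink) auto
  also have "\<dots> < 1 * M y" using assms Orlicz_pos[OF M, of y] by (intro mult_strict_right_mono) auto
  finally show ?thesis by simp
qed

lemma Orlicz_mono: "Orlicz M \<Longrightarrow> 0 \<le> x \<Longrightarrow> x \<le> y \<Longrightarrow> M x \<le> M y"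
  using Orlicz_strict_mono by (metis less_eq_real_def)

lemma Orlicz_continuous: "Orlicz M \<Longrightarrow> continuous_on UNIV M"
  by (intro convex_on_continuous Orlicz_convex) auto

lemma Orlicz_measurable: "Orlicz M \<Longrightarrow> M \<in> borel_measurable borel"
  by (intro borel_measurable_continuous_onI Orlicz_continuous)

text \<open>The point 1 is a convex combination of 0 and \<open>\<bar>x\<bar>\<close>. This growth
  makes \<open>M\<close> reach the value 1 and makes \<open>exp (\<beta> * M x)\<close> integrable
  for negative \<open>\<beta>\<close>.\<close>

lemma Orlicz_linear_growth:
  assumes M: "Orlicz M" and "1 \<le> \<bar>x\<bar>"
  shows "M 1 * \<bar>x\<bar> \<le> M x"
proof -
  have "M (1 / \<bar>x\<bar> * \<bar>x\<bar>) \<le> 1 / \<bar>x\<bar> * M \<bar>x\<bar>"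
    using assms by (intro Orlicz_shrink) auto
  moreover have "0 < \<bar>x\<bar>" using assms(2) by linarith
  ultimately show ?thesis using M by (simp add: Orlicz_abs field_simps)
qed

lemma Orlicz_inv_one:
  assumes M: "Orlicz M"
  shows "0 < Orlicz_inv M 1" "M (Orlicz_inv M 1) = 1"
proof -
  \<comment> \<open>Large enough for linear growth to force \<open>M b\<close> \<ge> 1, so that the
    intermediate value theorem applies on [0, b].\<close>
  define b where "b = max 1 (1 / M 1)"
  have b: "1 \<le> b" "1 / M 1 \<le> b" by (auto simp: b_def)
  have "0 < M 1" using Orlicz_pos[OF M] by simp
  then have "1 \<le> M 1 * \<bar>b\<bar>" using b by (simp add: field_simps)
  then have "1 \<le> M b" using Orlicz_linear_growth[OF M, of b] b by simp
  then obtain t where t: "0 \<le> t" "M t = 1"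
    using IVT'[of M 0 1 b] b Orlicz_zero[OF M] continuous_on_subset[OF Orlicz_continuous[OF M]] by auto
  have "inj_on M {0..}"
    by (rule linorder_inj_onI) (use Orlicz_strict_mono[OF M] in \<open>force+\<close>)
  then have "Orlicz_inv M 1 = t"
    unfolding Orlicz_inv_def using t by (intro the_inv_into_f_eq) auto
  moreover have "t \<noteq> 0" using t Orlicz_zero[OF M] by auto
  ultimately show "0 < Orlicz_inv M 1" "M (Orlicz_inv M 1) = 1" using t by auto
qed

section \<open>Volume bound for ellipsoids inside an Orlicz ball\<close>

lemma ellipsoid_in_Orlicz_ball_diagonal:
  assumes M: "Orlicz M" and "d > 0" and sub: "affine_map d L c ` unit_ball d \<subseteq> Orlicz_ball M d"
  shows "(\<Sum>i<d. M (L i i / sqrt (real d))) \<le> real d"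
proof -
  \<comment> \<open>The sign vector of S is in the unit ball after division by sqrt d. Flipping the i-th sign
    changes the i-th coordinate of its image only through L i i, so convexity and evenness bound
    M (L i i / sqrt d) by the average of M over the two images; sum over all S.\<close>
  define \<epsilon> where "\<epsilon> S j = (if j \<in> S then -1 else 1 :: real)" for S and j :: nat
  define flip where "flip i S = (if i \<in> S then S - {i} else insert i S)" for i :: nat and S
  define y where "y i S = c i + (\<Sum>j<d. L i j * (\<epsilon> S j / sqrt d))" for i S
  have pt: "(\<Sum>i<d. M (y i S)) \<le> real d" for S
  proof -
    have sq: "(\<epsilon> S j / sqrt d)\<^sup>2 = 1 / d" for j
      by (simp add: \<epsilon>_def power_divide)
    have "(\<lambda>j\<in>{..<d}. \<epsilon> S j / sqrt d) \<in> unit_ball d"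
      using \<open>d > 0\<close> by (simp add: unit_ball_def sq)
    then have "affine_map d L c (\<lambda>j\<in>{..<d}. \<epsilon> S j / sqrt d) \<in> Orlicz_ball M d"
      using sub by blast
    then show ?thesis by (simp add: Orlicz_ball_def affine_map_def y_def)
  qed
  have avg: "(\<Sum>S\<in>Pow {..<d}. M (L i i / sqrt d)) \<le> (\<Sum>S\<in>Pow {..<d}. M (y i S))" if i: "i < d" for i
  proof -
    have \<epsilon>_flip: "\<epsilon> (flip i S) j = (if j = i then - \<epsilon> S j else \<epsilon> S j)" for S j
    proof -
      have "j \<in> flip i S \<longleftrightarrow> (if j = i then j \<notin> S else j \<in> S)"
        by (cases "i \<in> S") (auto simp: flip_def)
      then show ?thesis by (simp add: \<epsilon>_def)
    qed
    have mid: "2 * M (L i i / sqrt d) \<le> M (y i S) + M (y i (flip i S))" for S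
    proof -
      have "y i S - y i (flip i S) = (\<Sum>j<d. if j = i then 2 * (L i i * \<epsilon> S i / sqrt d) else 0)"
        unfolding y_def add_diff_cancel_left sum_subtractf[symmetric]
        by (intro sum.cong refl) (simp add: \<epsilon>_flip)
      also have "\<dots> = 2 * (L i i * \<epsilon> S i / sqrt d)" using i by simp
      finally have "L i i * \<epsilon> S i / sqrt d = (1 - 1/2) *\<^sub>R y i S + (1/2) *\<^sub>R (- y i (flip i S))"
        by simp
      then have "M (L i i * \<epsilon> S i / sqrt d) \<le> (1 - 1/2) * M (y i S) + 1/2 * M (- y i (flip i S))"
        using convex_onD[OF Orlicz_convex[OF M], of "1/2" "y i S" "- y i (flip i S)"] by simp
      moreover have "M (L i i * \<epsilon> S i / sqrt d) = M (L i i / sqrt d)"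
        by (simp add: \<epsilon>_def Orlicz_minus[OF M])
      ultimately show ?thesis by (simp add: Orlicz_minus[OF M])
    qed
    have "(\<Sum>S\<in>Pow {..<d}. M (y i (flip i S))) = (\<Sum>S\<in>Pow {..<d}. M (y i S))"
    proof (rule sum.reindex_bij_witness[of _ "flip i" "flip i"])
      show "flip i (flip i S) = S" for S by (cases "i \<in> S") (auto simp: flip_def)
      show "flip i S \<in> Pow {..<d}" if "S \<in> Pow {..<d}" for S
        using that i by (auto simp: flip_def)
    qed (use i in \<open>auto simp: flip_def\<close>)
    moreover have "(\<Sum>S\<in>Pow {..<d}. 2 * M (L i i / sqrt d)) \<le>
        (\<Sum>S\<in>Pow {..<d}. M (y i S) + M (y i (flip i S)))"
      by (intro sum_mono mid)
    ultimately show ?thesis by (simp add: sum.distrib)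
  qed
  have "2 ^ d * (\<Sum>i<d. M (L i i / sqrt d)) = (\<Sum>i<d. \<Sum>S\<in>Pow {..<d}. M (L i i / sqrt d))"
    by (simp add: sum_distrib_left card_Pow)
  also have "\<dots> \<le> (\<Sum>i<d. \<Sum>S\<in>Pow {..<d}. M (y i S))"
    by (intro sum_mono avg) auto
  also have "\<dots> = (\<Sum>S\<in>Pow {..<d}. \<Sum>i<d. M (y i S))" by (rule sum.swap)
  also have "\<dots> \<le> (\<Sum>S\<in>Pow {..<d}. real d)" by (intro sum_mono pt)
  also have "\<dots> = 2 ^ d * real d" by (simp add: card_Pow)
  finally show ?thesis by simp
qed

text \<open>Jensen applied to the mean \<open>m\<close> of the \<open>\<bar>L i i\<bar>\<close>
  turns the diagonal bound into \<open>M (m / sqrt d)\<close> \<le> 1, hence \<open>m\<close> \<le>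
  \<open>sqrt d * Orlicz_inv M 1\<close>; by AM-GM the product is at most
  \<open>m ^ d\<close>.\<close>

lemma ellipsoid_in_Orlicz_ball_determinant:
  assumes M: "Orlicz M" and "d > 0" and sub: "affine_map d L c ` unit_ball d \<subseteq> Orlicz_ball M d"
  shows "(\<Prod>i<d. \<bar>L i i\<bar>) \<le> (sqrt (real d) * Orlicz_inv M 1) ^ d"
proof -
  define m where "m = (\<Sum>i<d. \<bar>L i i\<bar>) / d"
  have m: "0 \<le> m" by (simp add: m_def sum_nonneg)
  have "M (m / sqrt d) = M (\<Sum>i<d. (1 / d) *\<^sub>R (\<bar>L i i\<bar> / sqrt d))"
    by (simp add: m_def sum_divide_distrib mult.commute)
  also have "\<dots> \<le> (\<Sum>i<d. 1 / d * M (\<bar>L i i\<bar> / sqrt d))"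
    using \<open>d > 0\<close> by (intro convex_on_sum[OF _ _ Orlicz_convex[OF M]]) auto
  also have "\<dots> = (\<Sum>i<d. M (L i i / sqrt d)) / d"
  proof -
    have "M (\<bar>x\<bar> / sqrt d) = M (x / sqrt d)" for x
      using Orlicz_abs[OF M, of "x / sqrt d"] by simp
    then show ?thesis by (simp add: sum_divide_distrib)
  qed
  also have "\<dots> \<le> 1"
    using ellipsoid_in_Orlicz_ball_diagonal[OF assms] \<open>d > 0\<close> by simp
  finally have "m / sqrt d \<le> Orlicz_inv M 1"
    using Orlicz_strict_mono[OF M, of "Orlicz_inv M 1" "m / sqrt d"] Orlicz_inv_one[OF M] by force
  then have m_le: "m \<le> sqrt d * Orlicz_inv M 1" using \<open>d > 0\<close> by (simp add: field_simps)
  have "(\<Prod>i<d. \<bar>L i i\<bar>) powr (1 / card {..<d}) \<le> (\<Sum>i<d. \<bar>L i i\<bar> / card {..<d})"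
    using \<open>d > 0\<close> by (intro arith_geom_mean) auto
  then have "(\<Prod>i<d. \<bar>L i i\<bar>) powr (1 / d) \<le> m" by (simp add: m_def sum_divide_distrib)
  then have "((\<Prod>i<d. \<bar>L i i\<bar>) powr (1 / d)) ^ d \<le> m ^ d"
    by (intro power_mono) auto
  also have "((\<Prod>i<d. \<bar>L i i\<bar>) powr (1 / d)) ^ d = (\<Prod>i<d. \<bar>L i i\<bar>)"
    using \<open>d > 0\<close>
    by (subst powr_realpow'[symmetric]) (auto simp: powr_powr prod_nonneg)
  also have "m ^ d \<le> (sqrt d * Orlicz_inv M 1) ^ d" using m m_le by (intro power_mono)
  finally show ?thesis .
qed

section \<open>Exponential integrals and the log partition function\<close>

text \<open>The function is dominated by the exponential density plus its reflection, divided by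
  \<open>l\<close>; the two sides differ only at 0, where the bound is 2.\<close>

lemma integrable_exp_minus_abs:
  fixes l :: real
  assumes "0 < l"
  shows "integrable lborel (\<lambda>x::real. exp (- (l * \<bar>x\<bar>)))"
proof -
  interpret prob_space "density lborel (exponential_density l)"
    using assms by (rule prob_space_exponential_density)
  have "integrable (density lborel (exponential_density l)) (\<lambda>x. 1::real)" by simp
  then have 1: "integrable lborel (exponential_density l)"
    by (subst (asm) integrable_density) (auto simp: assms exponential_density_nonneg)
  have 2: "integrable lborel (\<lambda>x. exponential_density l (- x))"
    using lborel_integrable_real_affine[OF 1, of "-1" 0] by simp
  have "integrable lborel (\<lambda>x. (exponential_density l x + exponential_density l (- x)) / l)"
    using 1 2 by auto
  then show ?thesis
    by (rule Bochner_Integration.integrable_bound)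
      (use assms in \<open>auto intro!: AE_I2 simp: exponential_density_def mult.commute\<close>)
qed

lemma integrable_exp_Orlicz:
  assumes M: "Orlicz M" and "\<beta> < 0"
  shows "integrable lborel (\<lambda>x. exp (\<beta> * M x))"
proof (rule Bochner_Integration.integrable_bound)
  have "0 < M 1" using Orlicz_pos[OF M] by simp
  then show "integrable lborel (\<lambda>x. exp (- (\<beta> * M 1)) * exp (- ((- \<beta> * M 1) * \<bar>x\<bar>)))"
    using \<open>\<beta> < 0\<close> by (intro integrable_mult_right integrable_exp_minus_abs) (simp add: mult_neg_pos)
  show "(\<lambda>x. exp (\<beta> * M x)) \<in> borel_measurable lborel"
    using Orlicz_measurable[OF M] by simp
  have "\<beta> * M x \<le> - (\<beta> * M 1) + \<beta> * M 1 * \<bar>x\<bar>" for x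
  proof -
    \<comment> \<open>Shifting by 1 extends the linear lower bound to all \<open>x\<close>: for
      \<open>\<bar>x\<bar>\<close> < 1 the left side is negative.\<close>
    have "M 1 * (\<bar>x\<bar> - 1) \<le> M x"
    proof (cases "1 \<le> \<bar>x\<bar>")
      case True
      then show ?thesis using Orlicz_linear_growth[OF M True] \<open>0 < M 1\<close> by (simp add: algebra_simps)
    next
      case False
      then have "M 1 * (\<bar>x\<bar> - 1) \<le> 0" using \<open>0 < M 1\<close> by (simp add: mult_le_0_iff)
      then show ?thesis using Orlicz_nonneg[OF M, of x] by linarith
    qed
    then have "\<beta> * M x \<le> \<beta> * (M 1 * (\<bar>x\<bar> - 1))" using \<open>\<beta> < 0\<close> by (intro mult_left_mono_neg) auto
    then show ?thesis by (simp add: algebra_simps)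
  qed
  then show "AE x in lborel. norm (exp (\<beta> * M x)) \<le> norm (exp (- (\<beta> * M 1)) * exp (- ((- \<beta> * M 1) * \<bar>x\<bar>)))"
    by (simp add: exp_add[symmetric])
qed

text \<open>For \<open>exp\<close> to undo \<open>ln\<close> the integral must be positive; the
  interval [0, 1] alone contributes at least \<open>exp (\<beta> * M 1)\<close>.\<close>

lemma exp_log_partition:
  assumes M: "Orlicz M" and "\<beta> < 0"
  shows "exp (log_partition M \<beta>) = (\<integral>x. exp (\<beta> * M x) \<partial>lborel)"
proof -
  have "exp (\<beta> * M 1) = (\<integral>x. exp (\<beta> * M 1) * indicator {0..1::real} x \<partial>lborel)" by simp
  also have "\<dots> \<le> (\<integral>x. exp (\<beta> * M x) \<partial>lborel)"
  proof (rule integral_mono[OF _ integrable_exp_Orlicz[OF assms]])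
    show "exp (\<beta> * M 1) * indicator {0..1} x \<le> exp (\<beta> * M x)" for x
      using Orlicz_mono[OF M, of x 1] \<open>\<beta> < 0\<close> by (auto simp: indicator_def)
  qed auto
  finally have "0 < (\<integral>x. exp (\<beta> * M x) \<partial>lborel)"
    by (rule less_le_trans[OF exp_gt_zero])
  then show ?thesis by (simp add: log_partition_def)
qed

text \<open>The exponential of the sum is a product of functions of single coordinates, so Fubini
  gives the \<open>d\<close>-th power of the one-dimensional integral.\<close>

lemma exp_Orlicz_sum:
  assumes M: "Orlicz M" and "\<beta> < 0"
  shows "integrable (lborel_Rd d) (\<lambda>x. exp (\<beta> * (\<Sum>i<d. M (x i))))"
    and "(\<integral>x. exp (\<beta> * (\<Sum>i<d. M (x i))) \<partial>lborel_Rd d) = exp (real d * log_partition M \<beta>)"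
proof -
  have *: "exp (\<beta> * (\<Sum>i<d. M (x i))) = (\<Prod>i<d. exp (\<beta> * M (x i)))" for x :: "nat \<Rightarrow> real"
    by (simp add: sum_distrib_left exp_sum)
  show "integrable (lborel_Rd d) (\<lambda>x. exp (\<beta> * (\<Sum>i<d. M (x i))))"
    unfolding * by (intro lborel_Rd.product_integrable_prod integrable_exp_Orlicz[OF assms]) simp
  have "(\<integral>x. exp (\<beta> * (\<Sum>i<d. M (x i))) \<partial>lborel_Rd d) = (\<Prod>i<d. \<integral>x. exp (\<beta> * M x) \<partial>lborel)"
    unfolding * by (intro lborel_Rd.product_integral_prod integrable_exp_Orlicz[OF assms]) simp
  then show "(\<integral>x. exp (\<beta> * (\<Sum>i<d. M (x i))) \<partial>lborel_Rd d) = exp (real d * log_partition M \<beta>)"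
    by (simp add: exp_log_partition[OF assms, symmetric] exp_of_nat_mult)
qed

section \<open>Chernoff bounds for sublevel sets\<close>

lemma sets_Orlicz_halfspace:
  assumes M: "Orlicz M"
  shows "{x \<in> Rd d. s * (\<Sum>i<d. M (x i)) \<ge> u} \<in> sets (lborel_Rd d)"
proof -
  note [measurable] = Orlicz_measurable[OF M]
  show ?thesis unfolding space_lborel_Rd[symmetric] by measurable
qed

text \<open>Exponential Markov inequality: on \<open>S\<close> the factor exp (s (sum M - d u)) is
  at least 1. The sign of \<open>s\<close> selects the tail. Weight \<open>a\<close> = 0 bounds
  volumes, \<open>a\<close> = \<open>\<alpha>\<close> bounds tails of the tilted density.\<close>

lemma Orlicz_chernoff:
  fixes u s a :: real and d :: nat
  assumes M: "Orlicz M" and as: "a + s < 0"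
  defines "S \<equiv> {x \<in> Rd d. s * (\<Sum>i<d. M (x i)) \<ge> s * (real d * u)}"
  shows "integrable (lborel_Rd d) (\<lambda>x. exp (a * (\<Sum>i<d. M (x i))) * indicator S x)"
    and "(\<integral>x. exp (a * (\<Sum>i<d. M (x i))) * indicator S x \<partial>lborel_Rd d)
      \<le> exp (real d * (log_partition M (a + s) - s * u))"
proof -
  note [measurable] = Orlicz_measurable[OF M]
  have [measurable]: "S \<in> sets (lborel_Rd d)"
    unfolding S_def by (rule sets_Orlicz_halfspace[OF M])
  let ?g = "\<lambda>x. exp (- (s * (real d * u))) * exp ((a + s) * (\<Sum>i<d. M (x i)))"
  have int: "integrable (lborel_Rd d) ?g"
    by (intro integrable_mult_right exp_Orlicz_sum(1)[OF M as])
  have le: "exp (a * (\<Sum>i<d. M (x i))) * indicator S x \<le> ?g x" for x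
    by (auto simp: indicator_def S_def exp_add[symmetric] algebra_simps)
  show 1: "integrable (lborel_Rd d) (\<lambda>x. exp (a * (\<Sum>i<d. M (x i))) * indicator S x)"
    by (rule Bochner_Integration.integrable_bound[OF int]) (auto intro!: AE_I2 simp: abs_mult le)
  have "(\<integral>x. exp (a * (\<Sum>i<d. M (x i))) * indicator S x \<partial>lborel_Rd d) \<le> (\<integral>x. ?g x \<partial>lborel_Rd d)"
    by (intro integral_mono 1 int le)
  also have "\<dots> = exp (- (s * (real d * u))) * exp (real d * log_partition M (a + s))"
    by (simp add: exp_Orlicz_sum(2)[OF M as])
  also have "\<dots> = exp (real d * (log_partition M (a + s) - s * u))"
    by (simp add: exp_add[symmetric] algebra_simps)
  finally show "(\<integral>x. exp (a * (\<Sum>i<d. M (x i))) * indicator S x \<partial>lborel_Rd d)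
      \<le> exp (real d * (log_partition M (a + s) - s * u))" .
qed

lemma Orlicz_sublevel_eq:
  assumes "\<alpha> < 0"
  shows "{x \<in> Rd d. (\<Sum>i<d. M (x i)) \<le> real d * u} =
    {x \<in> Rd d. \<alpha> * (\<Sum>i<d. M (x i)) \<ge> \<alpha> * (real d * u)}"
  using assms by (simp add: mult_le_cancel_left)

text \<open>Finiteness is the Chernoff bound with \<open>a\<close> = 0 and \<open>s\<close> = -1. It
  is needed for monotonicity of \<open>measure\<close>, which is 0 on sets of infinite
  measure.\<close>

lemma Orlicz_sublevel_fmeasurable:
  assumes M: "Orlicz M"
  shows "{x \<in> Rd d. (\<Sum>i<d. M (x i)) \<le> real d * u} \<in> fmeasurable (lborel_Rd d)"
proof -
  have "integrable (lborel_Rd d) (indicator {x \<in> Rd d. (\<Sum>i<d. M (x i)) \<le> real d * u} :: _ \<Rightarrow> real)"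
    unfolding Orlicz_sublevel_eq[of "-1", simplified]
    using Orlicz_chernoff(1)[OF M, of 0 "-1" d u] by simp
  then show ?thesis
    using sets_Orlicz_halfspace[OF M, where s = "-1" and u = "- (real d * u)"]
    by (auto simp: fmeasurable_def integrable_indicator_iff space_lborel_Rd Int_def conj_ac)
qed

text \<open>The Chernoff bound with \<open>a\<close> = 0, \<open>s\<close> = \<open>\<alpha>\<close>
  and \<open>u\<close> = 1.\<close>

lemma vol_Orlicz_ball_upper:
  assumes M: "Orlicz M" and "\<alpha> < 0"
  shows "vol d (Orlicz_ball M d) \<le> exp (real d * (log_partition M \<alpha> - \<alpha>))"
proof -
  have "Orlicz_ball M d = {x \<in> Rd d. \<alpha> * (\<Sum>i<d. M (x i)) \<ge> \<alpha> * (real d * 1)}"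
    using Orlicz_sublevel_eq[OF assms(2), of d M 1] by (simp add: Orlicz_ball_def)
  then have "(\<integral>x. indicator (Orlicz_ball M d) x \<partial>lborel_Rd d) \<le> exp (real d * (log_partition M \<alpha> - \<alpha>))"
    using Orlicz_chernoff(2)[OF M, of 0 \<alpha> d 1] assms by simp
  moreover have "Orlicz_ball M d \<inter> space (lborel_Rd d) = Orlicz_ball M d"
    by (auto simp: space_lborel_Rd Orlicz_ball_def)
  ultimately show ?thesis by (simp add: vol_def)
qed

text \<open>The weight exp (\<alpha> sum M) has total mass
  \<open>exp (real d * log_partition M \<alpha>)\<close>. Because the derivative is 1, both tails
  outside d (1 - \<epsilon>) < sum M < d (1 + \<epsilon>) carry an exponentially small fraction of
  it. Between them the weight is at most
  \<open>exp (\<alpha> * (real d * (1 - \<epsilon>)))\<close>, so the volume must account for the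
  rest.\<close>

lemma vol_Orlicz_sublevel_lower:
  assumes M: "Orlicz M" and \<alpha>: "\<alpha> < 0"
    and deriv: "(log_partition M has_real_derivative 1) (at \<alpha>)" and "0 < \<epsilon>"
  obtains q\<^sub>1 q\<^sub>2 where "0 < q\<^sub>1" "q\<^sub>1 < 1" "0 < q\<^sub>2" "q\<^sub>2 < 1"
    "\<And>d. exp (real d * (log_partition M \<alpha> - \<alpha> * (1 - \<epsilon>))) * (1 - q\<^sub>1 ^ d - q\<^sub>2 ^ d)
      \<le> vol d {x \<in> Rd d. (\<Sum>i<d. M (x i)) \<le> real d * (1 + \<epsilon>)}"
proof -
  define \<phi> where "\<phi> = log_partition M"
  \<comment> \<open>The derivative is -\<epsilon>, so a small step to the right strictly lowers this
    function; that is exactly negativity of the upper tail exponent \<open>e\<^sub>1\<close>. The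
    lower tail uses a step to the left.\<close>
  have "((\<lambda>b. \<phi> b - b * (1 + \<epsilon>)) has_real_derivative (1 - (1 + \<epsilon>))) (at \<alpha>)"
    unfolding \<phi>_def by (auto intro!: derivative_eq_intros deriv)
  from has_real_derivative_neg_dec_right[OF this] obtain \<delta>\<^sub>1 where \<delta>\<^sub>1: "\<delta>\<^sub>1 > 0"
    "\<And>h. 0 < h \<Longrightarrow> h < \<delta>\<^sub>1 \<Longrightarrow> \<phi> (\<alpha> + h) - (\<alpha> + h) * (1 + \<epsilon>) < \<phi> \<alpha> - \<alpha> * (1 + \<epsilon>)"
    using \<open>0 < \<epsilon>\<close> by auto
  \<comment> \<open>The second bound keeps \<open>\<alpha> + s\<close> negative, as the Chernoff
    bound requires.\<close>
  define s where "s = min (\<delta>\<^sub>1 / 2) (- \<alpha> / 2)"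
  have s: "0 < s" "s < \<delta>\<^sub>1" "\<alpha> + s < 0" using \<delta>\<^sub>1(1) \<alpha> by (auto simp: s_def min_def)
  have "((\<lambda>b. \<phi> b - b * (1 - \<epsilon>)) has_real_derivative (1 - (1 - \<epsilon>))) (at \<alpha>)"
    unfolding \<phi>_def by (auto intro!: derivative_eq_intros deriv)
  from has_real_derivative_pos_inc_left[OF this] obtain \<delta>\<^sub>2 where \<delta>\<^sub>2: "\<delta>\<^sub>2 > 0"
    "\<And>h. 0 < h \<Longrightarrow> h < \<delta>\<^sub>2 \<Longrightarrow> \<phi> (\<alpha> - h) - (\<alpha> - h) * (1 - \<epsilon>) < \<phi> \<alpha> - \<alpha> * (1 - \<epsilon>)"
    using \<open>0 < \<epsilon>\<close> by auto
  define t where "t = \<delta>\<^sub>2 / 2"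
  have t: "0 < t" "t < \<delta>\<^sub>2" "\<alpha> + - t < 0" using \<delta>\<^sub>2(1) \<alpha> by (auto simp: t_def)
  define e\<^sub>1 where "e\<^sub>1 = \<phi> (\<alpha> + s) - s * (1 + \<epsilon>) - \<phi> \<alpha>"
  define e\<^sub>2 where "e\<^sub>2 = \<phi> (\<alpha> + - t) - (- t) * (1 - \<epsilon>) - \<phi> \<alpha>"
  have e: "e\<^sub>1 < 0" "e\<^sub>2 < 0"
    using \<delta>\<^sub>1(2)[OF s(1,2)] \<delta>\<^sub>2(2)[OF t(1,2)] by (simp_all add: e\<^sub>1_def e\<^sub>2_def algebra_simps)
  show thesis
  proof (rule that[of "exp e\<^sub>1" "exp e\<^sub>2"])
    fix d :: nat
    define \<Sigma> where "\<Sigma> x = (\<Sum>i<d. M (x i))" for x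
    define S where "S = {x \<in> Rd d. \<Sigma> x \<le> real d * (1 + \<epsilon>)}"
    define T\<^sub>1 where "T\<^sub>1 = {x \<in> Rd d. s * \<Sigma> x \<ge> s * (real d * (1 + \<epsilon>))}"
    define T\<^sub>2 where "T\<^sub>2 = {x \<in> Rd d. (- t) * \<Sigma> x \<ge> (- t) * (real d * (1 - \<epsilon>))}"
    have fin: "S \<in> fmeasurable (lborel_Rd d)"
      unfolding S_def \<Sigma>_def by (rule Orlicz_sublevel_fmeasurable[OF M])
    have S_sub: "S \<inter> space (lborel_Rd d) = S" by (auto simp: S_def space_lborel_Rd)
    have int_S: "integrable (lborel_Rd d) (\<lambda>x. exp (\<alpha> * (real d * (1 - \<epsilon>))) * indicator S x)"
      using fin S_sub by (intro integrable_mult_right) (auto simp: integrable_indicator_iff fmeasurable_def)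
    have C\<^sub>1: "integrable (lborel_Rd d) (\<lambda>x. exp (\<alpha> * \<Sigma> x) * indicator T\<^sub>1 x)"
      "(\<integral>x. exp (\<alpha> * \<Sigma> x) * indicator T\<^sub>1 x \<partial>lborel_Rd d) \<le> exp (real d * (\<phi> (\<alpha> + s) - s * (1 + \<epsilon>)))"
      unfolding T\<^sub>1_def \<Sigma>_def \<phi>_def by (rule Orlicz_chernoff[OF M s(3)])+
    have C\<^sub>2: "integrable (lborel_Rd d) (\<lambda>x. exp (\<alpha> * \<Sigma> x) * indicator T\<^sub>2 x)"
      "(\<integral>x. exp (\<alpha> * \<Sigma> x) * indicator T\<^sub>2 x \<partial>lborel_Rd d) \<le> exp (real d * (\<phi> (\<alpha> + - t) - (- t) * (1 - \<epsilon>)))"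
      unfolding T\<^sub>2_def \<Sigma>_def \<phi>_def by (rule Orlicz_chernoff[OF M t(3)])+
    have "exp (real d * \<phi> \<alpha>) = (\<integral>x. exp (\<alpha> * \<Sigma> x) \<partial>lborel_Rd d)"
      using exp_Orlicz_sum(2)[OF M \<alpha>] by (simp add: \<phi>_def \<Sigma>_def)
    \<comment> \<open>\<open>S\<close>, \<open>T\<^sub>1\<close> and \<open>T\<^sub>2\<close> cover
      the space. They overlap, which is harmless since every summand is nonnegative.\<close>
    also have "\<dots> \<le> (\<integral>x. exp (\<alpha> * (real d * (1 - \<epsilon>))) * indicator S x + exp (\<alpha> * \<Sigma> x) * indicator T\<^sub>1 x
        + exp (\<alpha> * \<Sigma> x) * indicator T\<^sub>2 x \<partial>lborel_Rd d)"
    proof (rule integral_mono)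
      show "integrable (lborel_Rd d) (\<lambda>x. exp (\<alpha> * \<Sigma> x))"
        unfolding \<Sigma>_def by (rule exp_Orlicz_sum(1)[OF M \<alpha>])
      show "integrable (lborel_Rd d) (\<lambda>x. exp (\<alpha> * (real d * (1 - \<epsilon>))) * indicator S x
          + exp (\<alpha> * \<Sigma> x) * indicator T\<^sub>1 x + exp (\<alpha> * \<Sigma> x) * indicator T\<^sub>2 x)"
        by (intro Bochner_Integration.integrable_add int_S C\<^sub>1(1) C\<^sub>2(1))
      fix x assume x: "x \<in> space (lborel_Rd d)"
      show "exp (\<alpha> * \<Sigma> x) \<le> exp (\<alpha> * (real d * (1 - \<epsilon>))) * indicator S x
          + exp (\<alpha> * \<Sigma> x) * indicator T\<^sub>1 x + exp (\<alpha> * \<Sigma> x) * indicator T\<^sub>2 x"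
      proof (cases "x \<in> T\<^sub>1 \<or> x \<in> T\<^sub>2")
        case True
        then show ?thesis by (auto simp: indicator_def)
      next
        case False
        then have "\<Sigma> x < real d * (1 + \<epsilon>)" "real d * (1 - \<epsilon>) < \<Sigma> x"
          using x s t by (auto simp: T\<^sub>1_def T\<^sub>2_def space_lborel_Rd)
        \<comment> \<open>Negative \<open>\<alpha>\<close> reverses the lower bound on
          \<open>\<Sigma> x\<close> into an upper bound on the weight.\<close>
        then have "x \<in> S" "\<alpha> * \<Sigma> x \<le> \<alpha> * (real d * (1 - \<epsilon>))"
          using x \<alpha> by (auto simp: S_def space_lborel_Rd)
        then show ?thesis by (simp add: add_increasing2)
      qed
    qed
    also have "\<dots> = exp (\<alpha> * (real d * (1 - \<epsilon>))) * vol d S + (\<integral>x. exp (\<alpha> * \<Sigma> x) * indicator T\<^sub>1 x \<partial>lborel_Rd d)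
        + (\<integral>x. exp (\<alpha> * \<Sigma> x) * indicator T\<^sub>2 x \<partial>lborel_Rd d)"
      unfolding Bochner_Integration.integral_add[OF Bochner_Integration.integrable_add[OF int_S C\<^sub>1(1)] C\<^sub>2(1)]
        Bochner_Integration.integral_add[OF int_S C\<^sub>1(1)]
      using S_sub by (simp add: vol_def)
    also have "\<dots> \<le> exp (\<alpha> * (real d * (1 - \<epsilon>))) * vol d S + exp (real d * \<phi> \<alpha>) * exp e\<^sub>1 ^ d
        + exp (real d * \<phi> \<alpha>) * exp e\<^sub>2 ^ d"
    proof -
      have "exp (real d * \<phi> \<alpha>) * exp e\<^sub>1 ^ d = exp (real d * (\<phi> (\<alpha> + s) - s * (1 + \<epsilon>)))"
        by (simp add: e\<^sub>1_def exp_of_nat_mult[symmetric] exp_add[symmetric] algebra_simps)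
      moreover have "exp (real d * \<phi> \<alpha>) * exp e\<^sub>2 ^ d = exp (real d * (\<phi> (\<alpha> + - t) - (- t) * (1 - \<epsilon>)))"
        by (simp add: e\<^sub>2_def exp_of_nat_mult[symmetric] exp_add[symmetric] algebra_simps)
      ultimately show ?thesis using C\<^sub>1(2) C\<^sub>2(2) by linarith
    qed
    finally have "exp (real d * \<phi> \<alpha>) * (1 - exp e\<^sub>1 ^ d - exp e\<^sub>2 ^ d) \<le> exp (\<alpha> * (real d * (1 - \<epsilon>))) * vol d S"
      by (simp add: algebra_simps)
    then have "exp (- (\<alpha> * (real d * (1 - \<epsilon>)))) * (exp (real d * \<phi> \<alpha>) * (1 - exp e\<^sub>1 ^ d - exp e\<^sub>2 ^ d))
        \<le> exp (- (\<alpha> * (real d * (1 - \<epsilon>)))) * (exp (\<alpha> * (real d * (1 - \<epsilon>))) * vol d S)"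
      by (rule mult_left_mono) simp
    also have "\<dots> = vol d S" by (simp add: exp_minus)
    also have "exp (- (\<alpha> * (real d * (1 - \<epsilon>)))) * (exp (real d * \<phi> \<alpha>) * (1 - exp e\<^sub>1 ^ d - exp e\<^sub>2 ^ d))
       = exp (real d * (\<phi> \<alpha> - \<alpha> * (1 - \<epsilon>))) * (1 - exp e\<^sub>1 ^ d - exp e\<^sub>2 ^ d)"
    proof -
      have "- (\<alpha> * (real d * (1 - \<epsilon>))) + real d * \<phi> \<alpha> = real d * (\<phi> \<alpha> - \<alpha> * (1 - \<epsilon>))"
        by (simp add: algebra_simps)
      then show ?thesis by (metis exp_add mult.assoc)
    qed
    finally show "exp (real d * (log_partition M \<alpha> - \<alpha> * (1 - \<epsilon>))) * (1 - exp e\<^sub>1 ^ d - exp e\<^sub>2 ^ d)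
      \<le> vol d {x \<in> Rd d. (\<Sum>i<d. M (x i)) \<le> real d * (1 + \<epsilon>)}"
      by (simp add: \<phi>_def S_def \<Sigma>_def)
  qed (use e in auto)
qed

section \<open>Scaling and the growth rate of the volume\<close>

text \<open>Homothety in matrix form, so that scaled balls are images under
  \<open>affine_map\<close>, as \<open>ellipsoid\<close> demands, and the triangular volume formula
  applies.\<close>

definition scaling :: "real \<Rightarrow> nat \<Rightarrow> nat \<Rightarrow> real" where
  "scaling k i j = (if i = j then k else 0)"

lemma affine_map_scaling: "affine_map d (scaling k) (\<lambda>_. 0) x = (\<lambda>i\<in>{..<d}. k * x i)"
proof -
  have "(\<Sum>j<d. scaling k i j * x j) = k * x i" if "i < d" for i
  proof -
    have "(\<Sum>j<d. scaling k i j * x j) = (\<Sum>j<d. if j = i then k * x i else 0)"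
      by (intro sum.cong) (auto simp: scaling_def)
    then show ?thesis using that by simp
  qed
  then show ?thesis by (auto simp: affine_map_def restrict_def)
qed

text \<open>Writing the image as a preimage under division by \<open>k\<close> yields its
  measurability.\<close>

lemma scaling_image:
  assumes "k \<noteq> 0" "S \<subseteq> Rd d"
  shows "affine_map d (scaling k) (\<lambda>_. 0) ` S = {y \<in> Rd d. (\<lambda>i\<in>{..<d}. y i / k) \<in> S}"
proof (intro equalityI subsetI)
  fix y assume "y \<in> affine_map d (scaling k) (\<lambda>_. 0) ` S"
  then obtain x where x: "x \<in> S" and y: "y = (\<lambda>i\<in>{..<d}. k * x i)"
    by (auto simp: affine_map_scaling)
  have "(\<lambda>i\<in>{..<d}. y i / k) = x"
    using x assms by (intro Rd_eqI[of _ d]) (auto simp: y)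
  then show "y \<in> {y \<in> Rd d. (\<lambda>i\<in>{..<d}. y i / k) \<in> S}"
    using x by (simp add: y)
next
  fix y assume y: "y \<in> {y \<in> Rd d. (\<lambda>i\<in>{..<d}. y i / k) \<in> S}"
  then have "y = affine_map d (scaling k) (\<lambda>_. 0) (\<lambda>i\<in>{..<d}. y i / k)"
    using assms by (intro Rd_eqI[of _ d]) (auto simp: affine_map_scaling)
  then show "y \<in> affine_map d (scaling k) (\<lambda>_. 0) ` S" using y by auto
qed

lemma vol_scaling:
  assumes "0 < k" and S: "S \<in> sets (lborel_Rd d)"
  shows "affine_map d (scaling k) (\<lambda>_. 0) ` S \<in> sets (lborel_Rd d)"
    and "vol d (affine_map d (scaling k) (\<lambda>_. 0) ` S) = k ^ d * vol d S"
proof -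
  have "S \<subseteq> Rd d" using sets.sets_into_space[OF S] by (simp add: space_lborel_Rd)
  then have "affine_map d (scaling k) (\<lambda>_. 0) ` S = {y \<in> space (lborel_Rd d). (\<lambda>i\<in>{..<d}. y i / k) \<in> S}"
    using assms scaling_image by (simp add: space_lborel_Rd)
  also have "\<dots> \<in> sets (lborel_Rd d)" using S by measurable
  finally show *: "affine_map d (scaling k) (\<lambda>_. 0) ` S \<in> sets (lborel_Rd d)" .
  show "vol d (affine_map d (scaling k) (\<lambda>_. 0) ` S) = k ^ d * vol d S"
    using assms by (subst vol_triangular_image[OF _ _ S *]) (auto simp: scaling_def)
qed

text \<open>Convexity with \<open>M 0 = 0\<close> gives M (k x) \<le> k M x, so shrinking the larger
  sublevel set by 1 + \<epsilon> lands in the Orlicz ball.\<close>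

lemma vol_Orlicz_ball_scaled:
  assumes M: "Orlicz M" and "0 < \<epsilon>"
  shows "vol d {x \<in> Rd d. (\<Sum>i<d. M (x i)) \<le> real d * (1 + \<epsilon>)} \<le> (1 + \<epsilon>) ^ d * vol d (Orlicz_ball M d)"
proof -
  define S where "S = {x \<in> Rd d. (\<Sum>i<d. M (x i)) \<le> real d * (1 + \<epsilon>)}"
  define k where "k = 1 / (1 + \<epsilon>)"
  have k: "0 < k" "k \<le> 1" using \<open>0 < \<epsilon>\<close> by (simp_all add: k_def)
  have S: "S \<in> sets (lborel_Rd d)"
    unfolding S_def using Orlicz_sublevel_fmeasurable[OF M] by auto
  have fin: "Orlicz_ball M d \<in> fmeasurable (lborel_Rd d)"
    using Orlicz_sublevel_fmeasurable[OF M, of d 1] by (simp add: Orlicz_ball_def)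
  have "affine_map d (scaling k) (\<lambda>_. 0) ` S \<subseteq> Orlicz_ball M d"
  proof (clarsimp simp: affine_map_scaling Orlicz_ball_def S_def)
    fix x assume x: "(\<Sum>i<d. M (x i)) \<le> real d * (1 + \<epsilon>)"
    have "(\<Sum>i<d. M (k * x i)) \<le> (\<Sum>i<d. k * M (x i))"
      using k by (intro sum_mono Orlicz_shrink[OF M]) auto
    also have "\<dots> = k * (\<Sum>i<d. M (x i))" by (simp add: sum_distrib_left)
    also have "\<dots> \<le> k * (real d * (1 + \<epsilon>))" using x k by (intro mult_left_mono) auto
    also have "\<dots> = real d" using \<open>0 < \<epsilon>\<close> by (simp add: k_def)
    finally show "(\<Sum>i<d. M (k * x i)) \<le> real d" .
  qed
  then have "vol d (affine_map d (scaling k) (\<lambda>_. 0) ` S) \<le> vol d (Orlicz_ball M d)"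
    unfolding vol_def using vol_scaling(1)[OF k(1) S] fin by (intro measure_mono_fmeasurable)
  then have "k ^ d * vol d S \<le> vol d (Orlicz_ball M d)"
    by (simp add: vol_scaling(2)[OF k(1) S])
  then show ?thesis
    using \<open>0 < \<epsilon>\<close> by (simp add: S_def k_def power_one_over field_simps)
qed

lemma vol_nonneg [simp]: "0 \<le> vol d S"
  by (simp add: vol_def)

text \<open>The upper bound holds for every positive \<open>d\<close>. For the lower one, \<epsilon>
  is fixed first, small enough that the rate \<open>b\<close> still exceeds \<open>y\<close>; the
  remaining factor is eventually above 1/2, and its \<open>d\<close>-th root costs nothing in the
  limit.\<close>

lemma vol_Orlicz_ball_tendsto:
  assumes M: "Orlicz M" and \<alpha>: "\<alpha> < 0"
    and deriv: "(log_partition M has_real_derivative 1) (at \<alpha>)"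
  shows "(\<lambda>d. vol d (Orlicz_ball M d) powr (1 / real d)) \<longlonglongrightarrow> exp (log_partition M \<alpha> - \<alpha>)"
proof (rule order_tendstoI)
  fix y assume y: "exp (log_partition M \<alpha> - \<alpha>) < y"
  show "\<forall>\<^sub>F d in sequentially. vol d (Orlicz_ball M d) powr (1 / real d) < y"
    using eventually_gt_at_top[of "0::nat"]
  proof eventually_elim
    case (elim d)
    have "vol d (Orlicz_ball M d) powr (1 / real d) \<le> exp (real d * (log_partition M \<alpha> - \<alpha>)) powr (1 / real d)"
      using vol_Orlicz_ball_upper[OF M \<alpha>] by (intro powr_mono2) auto
    also have "\<dots> = exp (log_partition M \<alpha> - \<alpha>)"
      using elim by (simp add: powr_def)
    finally show ?case using y by simp
  qed
next
  define \<phi> where "\<phi> = log_partition M \<alpha>"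
  fix y assume "y < exp (log_partition M \<alpha> - \<alpha>)"
  moreover have "((\<lambda>\<epsilon>. exp (\<phi> - \<alpha> * (1 - \<epsilon>)) / (1 + \<epsilon>)) \<longlongrightarrow> exp (\<phi> - \<alpha> * (1 - 0)) / (1 + 0)) (at_right 0)"
    by (intro tendsto_intros) auto
  ultimately have "\<forall>\<^sub>F \<epsilon> in at_right 0. y < exp (\<phi> - \<alpha> * (1 - \<epsilon>)) / (1 + \<epsilon>)"
    by (intro order_tendstoD(1)) (auto simp: \<phi>_def)
  moreover have "\<forall>\<^sub>F \<epsilon> in at_right 0. (0::real) < \<epsilon>"
    by (rule eventually_at_right_less)
  ultimately have "\<forall>\<^sub>F \<epsilon> in at_right 0. 0 < \<epsilon> \<and> y < exp (\<phi> - \<alpha> * (1 - \<epsilon>)) / (1 + \<epsilon>)"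
    by eventually_elim auto
  then obtain \<epsilon> :: real where \<epsilon>: "0 < \<epsilon>" "y < exp (\<phi> - \<alpha> * (1 - \<epsilon>)) / (1 + \<epsilon>)"
    using eventually_happens'[OF trivial_limit_at_right_real] by blast
  define b where "b = exp (\<phi> - \<alpha> * (1 - \<epsilon>)) / (1 + \<epsilon>)"
  have "0 < b" using \<epsilon> by (simp add: b_def)
  obtain q\<^sub>1 q\<^sub>2 where q: "0 < q\<^sub>1" "q\<^sub>1 < 1" "0 < q\<^sub>2" "q\<^sub>2 < 1"
    and lower: "\<And>d. exp (real d * (\<phi> - \<alpha> * (1 - \<epsilon>))) * (1 - q\<^sub>1 ^ d - q\<^sub>2 ^ d)
      \<le> vol d {x \<in> Rd d. (\<Sum>i<d. M (x i)) \<le> real d * (1 + \<epsilon>)}"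
    by (rule vol_Orlicz_sublevel_lower[OF M \<alpha> deriv \<epsilon>(1), folded \<phi>_def]) (rule that)
  have lower': "b ^ d * (1 - q\<^sub>1 ^ d - q\<^sub>2 ^ d) \<le> vol d (Orlicz_ball M d)" for d
  proof -
    have "exp (real d * (\<phi> - \<alpha> * (1 - \<epsilon>))) * (1 - q\<^sub>1 ^ d - q\<^sub>2 ^ d) \<le> (1 + \<epsilon>) ^ d * vol d (Orlicz_ball M d)"
      by (rule order_trans[OF lower vol_Orlicz_ball_scaled[OF M \<epsilon>(1)]])
    moreover have "0 < (1 + \<epsilon>) ^ d" using \<epsilon> by simp
    ultimately show ?thesis
      by (simp add: b_def power_divide exp_of_nat_mult[symmetric] divide_le_eq mult.commute)
  qed
  have "(\<lambda>d. 1 - q\<^sub>1 ^ d - q\<^sub>2 ^ d) \<longlonglongrightarrow> 1 - 0 - 0"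
    using q by (intro tendsto_intros LIMSEQ_power_zero) auto
  then have "\<forall>\<^sub>F d in sequentially. 1 / 2 < 1 - q\<^sub>1 ^ d - q\<^sub>2 ^ d"
    by (rule order_tendstoD(1)) simp
  moreover have "(\<lambda>d. b * (1 / 2) powr (1 / real d)) \<longlonglongrightarrow> b * (1 / 2) powr 0"
    by (intro tendsto_intros lim_1_over_n) auto
  then have "\<forall>\<^sub>F d in sequentially. y < b * (1 / 2) powr (1 / real d)"
    by (rule order_tendstoD(1)) (use \<epsilon> in \<open>simp add: b_def\<close>)
  ultimately show "\<forall>\<^sub>F d in sequentially. y < vol d (Orlicz_ball M d) powr (1 / real d)"
    using eventually_gt_at_top[of "0::nat"]
  proof eventually_elim
    case (elim d)
    have "b ^ d * (1 / 2) \<le> b ^ d * (1 - q\<^sub>1 ^ d - q\<^sub>2 ^ d)"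
      using elim \<open>0 < b\<close> by (intro mult_left_mono) auto
    then have "b ^ d * (1 / 2) \<le> vol d (Orlicz_ball M d)"
      using lower'[of d] by linarith
    then have le: "(b ^ d * (1 / 2)) powr (1 / real d) \<le> vol d (Orlicz_ball M d) powr (1 / real d)"
      using \<open>0 < b\<close> by (intro powr_mono2) auto
    have eq: "(b ^ d * c) powr (1 / real d) = b * c powr (1 / real d)" if "0 < c" for c
      using that \<open>0 < b\<close> elim(3) by (simp add: powr_mult powr_powr flip: powr_realpow)
    note elim(2)
    also have "b * (1 / 2) powr (1 / real d) = (b ^ d * (1 / 2)) powr (1 / real d)"
      by (rule eq[symmetric]) simp
    also note le
    finally show ?case .
  qed
qed

section \<open>The Euclidean ball as the Gaussian case\<close>

lemma Orlicz_square: "Orlicz (\<lambda>x::real. x\<^sup>2)"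
  by (auto simp: Orlicz_def convex_power2)

text \<open>The integrand is a multiple of the centred normal density with variance -1 / (2
  \<beta>).\<close>

lemma log_partition_square:
  assumes "\<beta> < 0"
  shows "log_partition (\<lambda>x. x\<^sup>2) \<beta> = ln (pi / - \<beta>) / 2"
proof -
  define \<sigma> where "\<sigma> = sqrt (- 1 / (2 * \<beta>))"
  have \<sigma>: "\<sigma>\<^sup>2 = - 1 / (2 * \<beta>)" using assms by (simp add: \<sigma>_def divide_nonneg_neg)
  have pos: "0 < pi / - \<beta>" using assms by (simp add: divide_pos_neg)
  have "exp (\<beta> * x\<^sup>2) = sqrt (pi / - \<beta>) * normal_density 0 \<sigma> x" for x
  proof -
    have "2 * pi * \<sigma>\<^sup>2 = pi / - \<beta>" "- (x - 0)\<^sup>2 / (2 * \<sigma>\<^sup>2) = \<beta> * x\<^sup>2"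
      using assms by (simp_all add: \<sigma> field_simps)
    then show ?thesis using pos assms unfolding normal_density_def by simp
  qed
  moreover have "0 < \<sigma>" using assms by (simp add: \<sigma>_def divide_neg_neg)
  ultimately have "(\<integral>x. exp (\<beta> * x\<^sup>2) \<partial>lborel) = sqrt (pi / - \<beta>)" by simp
  then show ?thesis using pos by (simp add: log_partition_def ln_sqrt)
qed

text \<open>The derivative at \<beta> is -1 / (2 \<beta>), which singles out -1/2 as the critical
  parameter.\<close>

lemma log_partition_square_deriv:
  "(log_partition (\<lambda>x. x\<^sup>2) has_real_derivative 1) (at (- 1 / 2))"
proof (rule has_field_derivative_transform_within_open)
  show "((\<lambda>\<beta>. ln (pi / - \<beta>) / 2) has_real_derivative 1) (at (- 1 / 2))"
    by (auto intro!: derivative_eq_intros simp: field_simps)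
  show "ln (pi / - \<beta>) / 2 = log_partition (\<lambda>x. x\<^sup>2) \<beta>" if "\<beta> \<in> {..<0}" for \<beta>
    using that by (simp add: log_partition_square)
qed auto

lemma Orlicz_ball_square:
  assumes "0 < d"
  shows "Orlicz_ball (\<lambda>x. x\<^sup>2) d = affine_map d (scaling (sqrt d)) (\<lambda>_. 0) ` unit_ball d"
proof -
  have "(\<Sum>i<d. (y i / sqrt d)\<^sup>2) = (\<Sum>i<d. (y i)\<^sup>2) / d" for y
    by (simp add: power_divide sum_divide_distrib)
  moreover have "unit_ball d \<subseteq> Rd d" by (auto simp: unit_ball_def)
  ultimately show ?thesis
    using assms by (subst scaling_image) (auto simp: Orlicz_ball_def unit_ball_def)
qed

text \<open>The general limit for squares: at -1/2 the log partition function is ln (2 pi) / 2. The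
  factor \<open>sqrt d ^ d\<close> appears because the Orlicz ball of the square has radius
  \<open>sqrt d\<close>.\<close>

lemma vol_unit_ball_tendsto:
  "(\<lambda>d. (sqrt d ^ d * vol d (unit_ball d)) powr (1 / real d)) \<longlonglongrightarrow> sqrt (2 * pi * exp 1)"
proof -
  have "exp (log_partition (\<lambda>x. x\<^sup>2) (- 1 / 2) - (- 1 / 2)) = exp (ln (2 * pi) / 2) * exp (1 / 2)"
    by (simp add: log_partition_square exp_add[symmetric] mult.commute)
  also have "\<dots> = sqrt (2 * pi * exp 1)"
    by (rule real_sqrt_unique[symmetric]) (simp_all add: power_mult_distrib flip: exp_double)
  finally have "exp (log_partition (\<lambda>x. x\<^sup>2) (- 1 / 2) - (- 1 / 2)) = sqrt (2 * pi * exp 1)" .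
  with vol_Orlicz_ball_tendsto[OF Orlicz_square _ log_partition_square_deriv]
  have "(\<lambda>d. vol d (Orlicz_ball (\<lambda>x. x\<^sup>2) d) powr (1 / real d)) \<longlonglongrightarrow> sqrt (2 * pi * exp 1)"
    by simp
  moreover have "\<forall>\<^sub>F d in sequentially. vol d (Orlicz_ball (\<lambda>x. x\<^sup>2) d) powr (1 / real d) =
      (sqrt d ^ d * vol d (unit_ball d)) powr (1 / real d)"
    using eventually_gt_at_top[of "0::nat"]
    by eventually_elim (simp add: Orlicz_ball_square vol_scaling sets_unit_ball)
  ultimately show ?thesis by (rule Lim_transform_eventually)
qed

section \<open>The volume ratio of Orlicz balls\<close>

lemma ellipsoid_scaled_unit_ball:
  assumes "0 < k"
  shows "ellipsoid d (affine_map d (scaling k) (\<lambda>_. 0) ` unit_ball d)"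
proof -
  have "bij_betw (affine_map d (scaling k) (\<lambda>_. 0)) (Rd d) (Rd d)"
  proof (rule bij_betw_byWitness[where f' = "\<lambda>y. \<lambda>i\<in>{..<d}. y i / k"])
    show "\<forall>x\<in>Rd d. (\<lambda>i\<in>{..<d}. affine_map d (scaling k) (\<lambda>_. 0) x i / k) = x"
      using assms by (intro ballI Rd_eqI) (auto simp: affine_map_scaling)
    show "\<forall>y\<in>Rd d. affine_map d (scaling k) (\<lambda>_. 0) (\<lambda>i\<in>{..<d}. y i / k) = y"
      using assms by (intro ballI Rd_eqI) (auto simp: affine_map_scaling)
  qed auto
  then show ?thesis unfolding ellipsoid_def by blast
qed

text \<open>Jensen for the concave function M (sqrt t) at the squared coordinates bounds the mean of
  the \<open>M (y i)\<close> by \<open>M\<close> at the root mean square of \<open>y\<close>, which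
  is at most \<open>Orlicz_inv M 1\<close>.\<close>

lemma ball_in_Orlicz_ball:
  assumes M: "Orlicz M" and conc: "two_concave M" and "0 < d"
  shows "affine_map d (scaling (sqrt d * Orlicz_inv M 1)) (\<lambda>_. 0) ` unit_ball d \<subseteq> Orlicz_ball M d"
proof
  define t where "t = Orlicz_inv M 1"
  have t: "0 < t" "M t = 1" using Orlicz_inv_one[OF M] by (simp_all add: t_def)
  fix y assume "y \<in> affine_map d (scaling (sqrt d * Orlicz_inv M 1)) (\<lambda>_. 0) ` unit_ball d"
  then obtain x where x: "(\<Sum>i<d. (x i)\<^sup>2) \<le> 1" and y: "y = (\<lambda>i\<in>{..<d}. sqrt d * t * x i)"
    by (auto simp: affine_map_scaling unit_ball_def t_def)
  have "(\<Sum>i<d. 1 / d * M (sqrt ((y i)\<^sup>2))) \<le> M (sqrt (\<Sum>i<d. (1 / d) *\<^sub>R (y i)\<^sup>2))"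
    using conc \<open>0 < d\<close> unfolding two_concave_def by (intro concave_on_sum) auto
  also have "(\<Sum>i<d. (1 / d) *\<^sub>R (y i)\<^sup>2) = t\<^sup>2 * (\<Sum>i<d. (x i)\<^sup>2)"
    using \<open>0 < d\<close> by (simp add: y power_mult_distrib sum_distrib_left)
  also have "M (sqrt (t\<^sup>2 * (\<Sum>i<d. (x i)\<^sup>2))) \<le> M t"
    using x t by (intro Orlicz_mono[OF M])
      (auto simp: real_sqrt_mult sum_nonneg intro!: mult_left_le)
  finally have "(\<Sum>i<d. M (y i)) / d \<le> 1"
    using t by (simp add: Orlicz_abs[OF M] sum_divide_distrib)
  then show "y \<in> Orlicz_ball M d"
    using \<open>0 < d\<close> by (simp add: Orlicz_ball_def y)
qed

text \<open>The infimum is a minimum: the ball of radius \<open>sqrt d * Orlicz_inv M 1\<close> is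
  admissible and has the largest volume among the admissible ellipsoids.\<close>

lemma volume_ratio_Orlicz_ball:
  assumes M: "Orlicz M" and conc: "two_concave M" and "0 < d" and pos: "0 < vol d (unit_ball d)"
  shows "volume_ratio d (Orlicz_ball M d) =
    (vol d (Orlicz_ball M d) / ((sqrt d * Orlicz_inv M 1) ^ d * vol d (unit_ball d))) powr (1 / real d)"
proof -
  define r where "r = sqrt d * Orlicz_inv M 1"
  have r: "0 < r" using Orlicz_inv_one[OF M] \<open>0 < d\<close> by (simp add: r_def)
  let ?K = "Orlicz_ball M d"
  let ?B = "affine_map d (scaling r) (\<lambda>_. 0) ` unit_ball d"
  have vol_B: "vol d ?B = r ^ d * vol d (unit_ball d)"
    by (rule vol_scaling(2)[OF r sets_unit_ball])
  \<comment> \<open>Positivity matters since division by 0 yields 0: an ellipsoid of volume 0 would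
    drag the infimum down to 0.\<close>
  have vol_le: "0 < vol d E \<and> vol d E \<le> r ^ d * vol d (unit_ball d)" if E: "ellipsoid d E" "E \<subseteq> ?K" for E
  proof -
    obtain L c where L: "\<And>i j. i < j \<Longrightarrow> j < d \<Longrightarrow> L i j = 0" "\<And>i. i < d \<Longrightarrow> L i i \<noteq> 0"
      and E_eq: "E = affine_map d L c ` unit_ball d"
      using ellipsoid_triangular[OF E(1)] by metis
    have "vol d E = (\<Prod>i<d. \<bar>L i i\<bar>) * vol d (unit_ball d)"
      using sets_ellipsoid[OF E(1)] unfolding E_eq
      by (intro vol_triangular_image L sets_unit_ball)
    moreover have "0 < (\<Prod>i<d. \<bar>L i i\<bar>)" using L(2) by (intro prod_pos) auto
    moreover have "(\<Prod>i<d. \<bar>L i i\<bar>) \<le> r ^ d"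
      unfolding r_def using E(2) by (intro ellipsoid_in_Orlicz_ball_determinant[OF M \<open>0 < d\<close>]) (simp add: E_eq)
    ultimately show ?thesis using pos by (simp add: mult_right_mono)
  qed
  have "Inf ((\<lambda>E. (vol d ?K / vol d E) powr (1 / real d)) ` {E. ellipsoid d E \<and> E \<subseteq> ?K}) =
      (vol d ?K / vol d ?B) powr (1 / real d)"
  proof (rule cInf_eq_minimum)
    have "?B \<subseteq> ?K" unfolding r_def by (rule ball_in_Orlicz_ball[OF M conc \<open>0 < d\<close>])
    then show "(vol d ?K / vol d ?B) powr (1 / real d) \<in>
        (\<lambda>E. (vol d ?K / vol d E) powr (1 / real d)) ` {E. ellipsoid d E \<and> E \<subseteq> ?K}"
      using ellipsoid_scaled_unit_ball[OF r] by blast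
  next
    fix v assume "v \<in> (\<lambda>E. (vol d ?K / vol d E) powr (1 / real d)) ` {E. ellipsoid d E \<and> E \<subseteq> ?K}"
    then obtain E where E: "ellipsoid d E" "E \<subseteq> ?K" and v: "v = (vol d ?K / vol d E) powr (1 / real d)"
      by auto
    show "(vol d ?K / vol d ?B) powr (1 / real d) \<le> v"
      unfolding v vol_B using vol_le[OF E] r pos
      by (intro powr_mono2 divide_left_mono) auto
  qed
  then show ?thesis unfolding volume_ratio_def vol_B unfolding r_def .
qed

theorem theorem3:
  fixes M :: "real \<Rightarrow> real" and \<alpha> :: real
  assumes "Orlicz M"
    and "two_concave M"
    and "\<alpha> < 0"
    and "(log_partition M has_real_derivative 1) (at \<alpha>)"
  shows "(\<lambda>d. volume_ratio d (Orlicz_ball M d)) \<longlonglongrightarrow>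
    1 / (sqrt (2 * pi * exp 1) * Orlicz_inv M 1) * exp (log_partition M \<alpha> - \<alpha>)"
proof -
  define t where "t = Orlicz_inv M 1"
  have t: "0 < t" using Orlicz_inv_one[OF assms(1)] by (simp add: t_def)
  define a where "a d = vol d (Orlicz_ball M d) powr (1 / real d)" for d
  define b where "b d = (sqrt d ^ d * vol d (unit_ball d)) powr (1 / real d)" for d
  have b: "b \<longlonglongrightarrow> sqrt (2 * pi * exp 1)"
    unfolding b_def by (rule vol_unit_ball_tendsto)
  have "(\<lambda>d. a d / (b d * t)) \<longlonglongrightarrow> exp (log_partition M \<alpha> - \<alpha>) / (sqrt (2 * pi * exp 1) * t)"
    unfolding a_def using t
    by (intro tendsto_intros b vol_Orlicz_ball_tendsto assms) auto
  \<comment> \<open>The positive limit of \<open>b\<close> itself shows that the unit ball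
    eventually has nonzero volume, which the formula for the volume ratio presupposes.\<close>
  moreover have "\<forall>\<^sub>F d in sequentially. 0 < b d"
    by (rule order_tendstoD(1)[OF b]) simp
  then have "\<forall>\<^sub>F d in sequentially. a d / (b d * t) = volume_ratio d (Orlicz_ball M d)"
    using eventually_gt_at_top[of "0::nat"]
  proof eventually_elim
    case (elim d)
    have "vol d (unit_ball d) \<noteq> 0" using elim(1) by (auto simp: b_def)
    then have pos: "0 < vol d (unit_ball d)" using vol_nonneg[of d "unit_ball d"] by linarith
    define w where "w = sqrt d ^ d * vol d (unit_ball d)"
    have w: "0 < w" using pos elim(2) by (simp add: w_def)
    have "volume_ratio d (Orlicz_ball M d) = (vol d (Orlicz_ball M d) / (w * t ^ d)) powr (1 / real d)"
      using volume_ratio_Orlicz_ball[OF assms(1,2) elim(2) pos]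
      by (simp add: w_def t_def power_mult_distrib mult_ac)
    also have "\<dots> = a d / (w powr (1 / real d) * (t ^ d) powr (1 / real d))"
      using w t by (simp add: a_def powr_divide powr_mult)
    also have "(t ^ d) powr (1 / real d) = t"
      using t elim(2) by (simp add: powr_powr flip: powr_realpow)
    finally show ?case by (simp add: b_def w_def)
  qed
  ultimately have "(\<lambda>d. volume_ratio d (Orlicz_ball M d)) \<longlonglongrightarrow>
      exp (log_partition M \<alpha> - \<alpha>) / (sqrt (2 * pi * exp 1) * t)"
    by (rule Lim_transform_eventually)
  then show ?thesis by (simp add: t_def)
qed

end
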